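(* Let $(E,\mathcal L,\overline{\mathcal E})$ be a set-finite, receiver set-finite, weakly left-resolving labelled space, where $E$ has no sinks, such that for every $v\in E^0$ the generalized vertex $[v]_l$ is finite for some $l\geq1$. Let $(F,\mathcal L_F,\overline{\mathcal F})$ be the merged labelled space of $(E,\mathcal L,\overline{\mathcal E})$. Then $\{[v]_\infty\}\in\overline{\mathcal F}$ for every vertex $[v]_\infty\in F^0$, and $$C^*(E,\mathcal L,\overline{\mathcal E})\cong C^*(F,\mathcal L_F,\overline{\mathcal F}).$$
   Context: Labelled spaces. A directed graph $E=(E^0,E^1,r,s)$ has countable sets $E^0$ (vertices), $E^1$ (edges) and range, source maps $r,s:E^1\to E^0$; $E$ has no sinks if every vertex emits an edge. $E^n$ is the set of paths $\lambda=\lambda_1\cdots\lambda_n$ ($r(\lambda_i)=s(\lambda_{i+1})$), $E^{\le l}=\bigcup_{i=1}^lE^i$, $E^{\ge1}=\bigcup_{n\ge1}E^n$, and $r,s$ extend to paths. A labelled graph $(E,\mathcal L)$ over a countable alphabet $\mathcal A$ has a surjective labelling map $\mathcal L:E^1\to\mathcal A$, extended to paths by concatenation; $\mathcal L^*(E)=\mathcal L(E^{\ge1})$. For $\alpha\in\mathcal L^*(E)$ and $A\subset E^0$, $r(\alpha)=\{r(\lambda):\mathcal L(\lambda)=\alpha\}$ and $r(A,\alpha)=\{r(\lambda):\mathcal L(\lambda)=\alpha,\ s(\lambda)\in A\}$. A collection $\mathcal B\subset 2^{E^0}$ is accommodating if it contains $r(\alpha)$ for all $\alpha\in\mathcal L^*(E)$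 and is closed under $A\mapsto r(A,\alpha)$, finite unions and finite intersections; then $(E,\mathcal L,\mathcal B)$ is a labelled space. It is weakly left-resolving if $r(A,\alpha)\cap r(B,\alpha)=r(A\cap B,\alpha)$ for all $A,B\in\mathcal B$, $\alpha\in\mathcal L^*(E)$. With $AE^1=\{e\in E^1:s(e)\in A\}$, $E^1A=\{e\in E^1:r(e)\in A\}$, it is set-finite (receiver set-finite) if $\mathcal L(AE^1)$ ($\mathcal L(E^1A)$) is finite for all $A\in\mathcal B$. Generalized vertices and $\overline{\mathcal E}$. For $v,w\in E^0$, $v\sim_lw$ iff $\mathcal L(E^{\le l}v)=\mathcal L(E^{\le l}w)$, where $E^{\le l}v$ is the set of paths in $E^{\le l}$ with range $v$; $[v]_l$ is the $\sim_l$-class of $v$, called a generalized vertex. $\overline{\mathcal E}$ is the smallest accommodating set for $(E,\mathcal L)$ that is closed under relative complements ($A\setminus B\in\overline{\mathcal E}$ for $A,B\in\overline{\mathcal E}$); throughout it is understood that $\overline{\mathcal E}$ contains all generalized vertices $[v]_l$, $v\in E^0$, $l\ge1$ (equivalently, $\overline{\mathcal E}$ is the smallest accommodating set containing all generalized vertices). Merged labelled graph. Write $v\sim w$ iff $[v]_l=[w]_l$ for all $l\ge1$, and let $[v]_\infty$ be the $\sim$-class of $v$. $F^0=\{[v]_\infty:v\in E^0\}$. Each $\lambda\in E^1$ gives an edge $e_\lambda$ of $F$ from $[s(\lambda)]_\infty$ to $[r(\lambda)]_\infty$ with label $\mathcal L_F(e_\lambda)=\mathcal L(\lambda)$; two edges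 $e_{\lambda_1},e_{\lambda_2}$ with the same source, range and label are identified. $F^1=\{e_\lambda:\lambda\in E^1\}$, and $(F,\mathcal L_F)$ is the merged labelled graph of $(E,\mathcal L)$. $\overline{\mathcal F}$ is the smallest accommodating set for $(F,\mathcal L_F)$ closed under relative complements; $(F,\mathcal L_F,\overline{\mathcal F})$ is the merged labelled space. $C^*$-algebra. A representation of a labelled space $(E,\mathcal L,\mathcal B)$ consists of projections $\{p_A:A\in\mathcal B\}$ and partial isometries $\{s_a:a\in\mathcal A\}$ with: (i) $p_\emptyset=0$, $p_Ap_B=p_{A\cap B}$, $p_{A\cup B}=p_A+p_B-p_{A\cap B}$; (ii) $p_As_a=s_ap_{r(A,a)}$; (iii) $s_a^*s_a=p_{r(a)}$ and $s_a^*s_b=0$ unless $a=b$; (iv) if $\mathcal L(AE^1)$ is finite and non-empty, $p_A=\sum_{a\in\mathcal L(AE^1)}s_ap_{r(A,a)}s_a^*$. $C^*(E,\mathcal L,\mathcal B)$ is the $C^*$-algebra generated by a universal representation. *)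

theory Defs
  imports
    "HOL-Analysis.Abstract_Metric_Spaces"
    "HOL-Library.Countable_Set"
    "HOL-Library.Equipollence"
    "HOL-Algebra.Module"
    "Graph_Theory.Arc_Walk"
begin

section \<open>Labelled spaces\<close>

text \<open>
  A labelled graph is given by a digraph \<open>G\<close> (source map \<^const>\<open>tail\<close>, range map \<^const>\<open>head\<close>) and a
  labelling map \<open>L\<close> on its arcs. The alphabet is always \<open>L ` arcs G\<close>, so \<open>L\<close> is surjective onto it
  and it is countable. Digraphs may be infinite, with loops and parallel arcs.
\<close>

definition labelled_graph :: "('v, 'e) pre_digraph \<Rightarrow> ('e \<Rightarrow> 'a) \<Rightarrow> bool" where
  "labelled_graph G L \<longleftrightarrow> wf_digraph G \<and> countable (verts G) \<and> countable (arcs G)"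

definition no_sinks :: "('v, 'e) pre_digraph \<Rightarrow> bool" where
  "no_sinks G \<longleftrightarrow> (\<forall>v \<in> verts G. \<exists>e \<in> arcs G. tail G e = v)"

text \<open>Paths have length at least one, whereas \<^const>\<open>pre_digraph.awalk\<close> also allows the empty walk.\<close>

definition label_words :: "('v, 'e) pre_digraph \<Rightarrow> ('e \<Rightarrow> 'a) \<Rightarrow> 'a list set" where
  "label_words G L = {map L q | q u v. q \<noteq> [] \<and> pre_digraph.awalk G u q v}"

definition word_range :: "('v, 'e) pre_digraph \<Rightarrow> ('e \<Rightarrow> 'a) \<Rightarrow> 'a list \<Rightarrow> 'v set" where
  "word_range G L w = {v. \<exists>q u. q \<noteq> [] \<and> pre_digraph.awalk G u q v \<and> map L q = w}"

definition rel_range ::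
  "('v, 'e) pre_digraph \<Rightarrow> ('e \<Rightarrow> 'a) \<Rightarrow> 'v set \<Rightarrow> 'a list \<Rightarrow> 'v set" where
  "rel_range G L A w =
     {v. \<exists>q u. q \<noteq> [] \<and> pre_digraph.awalk G u q v \<and> map L q = w \<and> u \<in> A}"

definition out_labels :: "('v, 'e) pre_digraph \<Rightarrow> ('e \<Rightarrow> 'a) \<Rightarrow> 'v set \<Rightarrow> 'a set" where
  "out_labels G L A = L ` {e \<in> arcs G. tail G e \<in> A}"

definition in_labels :: "('v, 'e) pre_digraph \<Rightarrow> ('e \<Rightarrow> 'a) \<Rightarrow> 'v set \<Rightarrow> 'a set" where
  "in_labels G L A = L ` {e \<in> arcs G. head G e \<in> A}"

text \<open>Closure under finite unions includes the empty union.\<close>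

definition accommodating ::
  "('v, 'e) pre_digraph \<Rightarrow> ('e \<Rightarrow> 'a) \<Rightarrow> 'v set set \<Rightarrow> bool" where
  "accommodating G L B \<longleftrightarrow>
     B \<subseteq> Pow (verts G) \<and>
     (\<forall>w \<in> label_words G L. word_range G L w \<in> B) \<and>
     (\<forall>A \<in> B. \<forall>w \<in> label_words G L. rel_range G L A w \<in> B) \<and>
     {} \<in> B \<and>
     (\<forall>A \<in> B. \<forall>A' \<in> B. A \<union> A' \<in> B) \<and>
     (\<forall>A \<in> B. \<forall>A' \<in> B. A \<inter> A' \<in> B)"

definition labelled_space ::
  "('v, 'e) pre_digraph \<Rightarrow> ('e \<Rightarrow> 'a) \<Rightarrow> 'v set set \<Rightarrow> bool" where
  "labelled_space G L B \<longleftrightarrow> labelled_graph G L \<and> accommodating G L B"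

definition weakly_left_resolving ::
  "('v, 'e) pre_digraph \<Rightarrow> ('e \<Rightarrow> 'a) \<Rightarrow> 'v set set \<Rightarrow> bool" where
  "weakly_left_resolving G L B \<longleftrightarrow>
     (\<forall>A \<in> B. \<forall>A' \<in> B. \<forall>w \<in> label_words G L.
        rel_range G L A w \<inter> rel_range G L A' w = rel_range G L (A \<inter> A') w)"

definition set_finite ::
  "('v, 'e) pre_digraph \<Rightarrow> ('e \<Rightarrow> 'a) \<Rightarrow> 'v set set \<Rightarrow> bool" where
  "set_finite G L B \<longleftrightarrow> (\<forall>A \<in> B. finite (out_labels G L A))"

definition receiver_set_finite ::
  "('v, 'e) pre_digraph \<Rightarrow> ('e \<Rightarrow> 'a) \<Rightarrow> 'v set set \<Rightarrow> bool" where
  "receiver_set_finite G L B \<longleftrightarrow> (\<forall>A \<in> B. finite (in_labels G L A))"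

section \<open>Generalized vertices and the merged labelled graph\<close>

definition in_words :: "('v, 'e) pre_digraph \<Rightarrow> ('e \<Rightarrow> 'a) \<Rightarrow> nat \<Rightarrow> 'v \<Rightarrow> 'a list set" where
  "in_words G L l v =
     {map L q | q u. 1 \<le> length q \<and> length q \<le> l \<and> pre_digraph.awalk G u q v}"

definition gen_vertex :: "('v, 'e) pre_digraph \<Rightarrow> ('e \<Rightarrow> 'a) \<Rightarrow> nat \<Rightarrow> 'v \<Rightarrow> 'v set" where
  "gen_vertex G L l v = {w \<in> verts G. in_words G L l w = in_words G L l v}"

text \<open>
  The collection written \<open>E\<close> with a bar: the smallest accommodating set that is closed under
  relative complements and contains all generalized vertices. Containing the generalized vertices
  has to be demanded if \<open>G\<close> has sources: the other closure conditions only produce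
  subsets of finite unions of ranges of words.
\<close>

definition bar_family :: "('v, 'e) pre_digraph \<Rightarrow> ('e \<Rightarrow> 'a) \<Rightarrow> 'v set set" where
  "bar_family G L = \<Inter> {B. accommodating G L B \<and>
     (\<forall>A \<in> B. \<forall>A' \<in> B. A - A' \<in> B) \<and>
     (\<forall>v \<in> verts G. \<forall>l \<ge> 1. gen_vertex G L l v \<in> B)}"

definition inf_class :: "('v, 'e) pre_digraph \<Rightarrow> ('e \<Rightarrow> 'a) \<Rightarrow> 'v \<Rightarrow> 'v set" where
  "inf_class G L v = {w \<in> verts G. \<forall>l \<ge> 1. gen_vertex G L l w = gen_vertex G L l v}"

text \<open>
  The arcs of the merged graph are the triples (source, label, range), which identifies precisely
  those arcs that agree in these three data.
\<close>

definition merged_graph ::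
  "('v, 'e) pre_digraph \<Rightarrow> ('e \<Rightarrow> 'a) \<Rightarrow> ('v set, 'v set \<times> 'a \<times> 'v set) pre_digraph" where
  "merged_graph G L =
     \<lparr> verts = inf_class G L ` verts G,
       arcs = (\<lambda>e. (inf_class G L (tail G e), L e, inf_class G L (head G e))) ` arcs G,
       tail = (\<lambda>(x, a, y). x),
       head = (\<lambda>(x, a, y). y) \<rparr>"

definition merged_label :: "'v set \<times> 'a \<times> 'v set \<Rightarrow> 'a" where
  "merged_label = (\<lambda>(x, a, y). a)"

section \<open>C*-algebras\<close>

definition complex_ring :: "complex ring" where
  "complex_ring = \<lparr> carrier = UNIV, mult = (*), one = 1, zero = 0, add = (+) \<rparr>"

text \<open>
  C*-algebras need not be unital: the field \<^const>\<open>one\<close>, inherited from the record of rings, is never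
  used.
\<close>

record 'u star_algebra = "(complex, 'u) module" +
  adj :: "'u \<Rightarrow> 'u"
  nrm :: "'u \<Rightarrow> real"

text \<open>\<^const>\<open>Metric_space\<close> wants a symmetric, nonnegative function also outside the carrier.\<close>

definition nrm_dist :: "'u star_algebra \<Rightarrow> 'u \<Rightarrow> 'u \<Rightarrow> real" where
  "nrm_dist A x y =
     (if x \<in> carrier A \<and> y \<in> carrier A then nrm A (x \<ominus>\<^bsub>A\<^esub> y) else 0)"

locale cstar_algebra = module complex_ring A for A :: "'u star_algebra" (structure) +
  assumes mult_closed: "\<lbrakk>x \<in> carrier A; y \<in> carrier A\<rbrakk> \<Longrightarrow> x \<otimes> y \<in> carrier A"
    and mult_assoc: "\<lbrakk>x \<in> carrier A; y \<in> carrier A; z \<in> carrier A\<rbrakk> \<Longrightarrow>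
      (x \<otimes> y) \<otimes> z = x \<otimes> (y \<otimes> z)"
    and distrib_right: "\<lbrakk>x \<in> carrier A; y \<in> carrier A; z \<in> carrier A\<rbrakk> \<Longrightarrow>
      (x \<oplus> y) \<otimes> z = x \<otimes> z \<oplus> y \<otimes> z"
    and distrib_left: "\<lbrakk>x \<in> carrier A; y \<in> carrier A; z \<in> carrier A\<rbrakk> \<Longrightarrow>
      x \<otimes> (y \<oplus> z) = x \<otimes> y \<oplus> x \<otimes> z"
    and smult_mult_left: "\<lbrakk>x \<in> carrier A; y \<in> carrier A\<rbrakk> \<Longrightarrow> (c \<odot> x) \<otimes> y = c \<odot> (x \<otimes> y)"
    and smult_mult_right: "\<lbrakk>x \<in> carrier A; y \<in> carrier A\<rbrakk> \<Longrightarrow> x \<otimes> (c \<odot> y) = c \<odot> (x \<otimes> y)"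
    and adj_closed: "x \<in> carrier A \<Longrightarrow> adj A x \<in> carrier A"
    and adj_adj: "x \<in> carrier A \<Longrightarrow> adj A (adj A x) = x"
    and adj_add: "\<lbrakk>x \<in> carrier A; y \<in> carrier A\<rbrakk> \<Longrightarrow> adj A (x \<oplus> y) = adj A x \<oplus> adj A y"
    and adj_smult: "x \<in> carrier A \<Longrightarrow> adj A (c \<odot> x) = cnj c \<odot> adj A x"
    and adj_mult: "\<lbrakk>x \<in> carrier A; y \<in> carrier A\<rbrakk> \<Longrightarrow> adj A (x \<otimes> y) = adj A y \<otimes> adj A x"
    and nrm_nonneg: "x \<in> carrier A \<Longrightarrow> 0 \<le> nrm A x"
    and nrm_eq_0: "x \<in> carrier A \<Longrightarrow> nrm A x = 0 \<longleftrightarrow> x = \<zero>"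
    and nrm_triangle: "\<lbrakk>x \<in> carrier A; y \<in> carrier A\<rbrakk> \<Longrightarrow> nrm A (x \<oplus> y) \<le> nrm A x + nrm A y"
    and nrm_smult: "x \<in> carrier A \<Longrightarrow> nrm A (c \<odot> x) = cmod c * nrm A x"
    and nrm_mult: "\<lbrakk>x \<in> carrier A; y \<in> carrier A\<rbrakk> \<Longrightarrow> nrm A (x \<otimes> y) \<le> nrm A x * nrm A y"
    and cstar_identity: "x \<in> carrier A \<Longrightarrow> nrm A (adj A x \<otimes> x) = (nrm A x)\<^sup>2"
    and complete: "Metric_space.mcomplete (carrier A) (nrm_dist A)"

definition star_hom :: "'u star_algebra \<Rightarrow> 'w star_algebra \<Rightarrow> ('u \<Rightarrow> 'w) \<Rightarrow> bool" where
  "star_hom A B f \<longleftrightarrow>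
     f \<in> carrier A \<rightarrow> carrier B \<and>
     (\<forall>x \<in> carrier A. \<forall>y \<in> carrier A. f (x \<oplus>\<^bsub>A\<^esub> y) = f x \<oplus>\<^bsub>B\<^esub> f y) \<and>
     (\<forall>x \<in> carrier A. \<forall>y \<in> carrier A. f (x \<otimes>\<^bsub>A\<^esub> y) = f x \<otimes>\<^bsub>B\<^esub> f y) \<and>
     (\<forall>c. \<forall>x \<in> carrier A. f (c \<odot>\<^bsub>A\<^esub> x) = c \<odot>\<^bsub>B\<^esub> f x) \<and>
     (\<forall>x \<in> carrier A. f (adj A x) = adj B (f x))"

text \<open>A bijective *-homomorphism of C*-algebras is automatically isometric.\<close>

definition cstar_isomorphic :: "'u star_algebra \<Rightarrow> 'w star_algebra \<Rightarrow> bool" where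
  "cstar_isomorphic A B \<longleftrightarrow>
     cstar_algebra A \<and> cstar_algebra B \<and>
     (\<exists>f. star_hom A B f \<and> bij_betw f (carrier A) (carrier B))"

definition cstar_subalgebra :: "'u star_algebra \<Rightarrow> 'u set \<Rightarrow> bool" where
  "cstar_subalgebra A T \<longleftrightarrow>
     closedin (Metric_space.mtopology (carrier A) (nrm_dist A)) T \<and>
     \<zero>\<^bsub>A\<^esub> \<in> T \<and>
     (\<forall>x \<in> T. \<forall>y \<in> T. x \<oplus>\<^bsub>A\<^esub> y \<in> T) \<and>
     (\<forall>x \<in> T. \<forall>y \<in> T. x \<otimes>\<^bsub>A\<^esub> y \<in> T) \<and>
     (\<forall>c. \<forall>x \<in> T. c \<odot>\<^bsub>A\<^esub> x \<in> T) \<and>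
     (\<forall>x \<in> T. adj A x \<in> T)"

definition generates :: "'u star_algebra \<Rightarrow> 'u set \<Rightarrow> bool" where
  "generates A S \<longleftrightarrow>
     S \<subseteq> carrier A \<and> (\<forall>T. cstar_subalgebra A T \<and> S \<subseteq> T \<longrightarrow> T = carrier A)"

definition is_projection :: "'u star_algebra \<Rightarrow> 'u \<Rightarrow> bool" where
  "is_projection A x \<longleftrightarrow> x \<in> carrier A \<and> adj A x = x \<and> x \<otimes>\<^bsub>A\<^esub> x = x"

definition is_partial_isometry :: "'u star_algebra \<Rightarrow> 'u \<Rightarrow> bool" where
  "is_partial_isometry A x \<longleftrightarrow>
     x \<in> carrier A \<and> x \<otimes>\<^bsub>A\<^esub> adj A x \<otimes>\<^bsub>A\<^esub> x = x"

section \<open>The C*-algebra of a labelled space\<close>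

text \<open>The values of \<open>p\<close> outside \<open>B\<close> and of \<open>s\<close> outside the alphabet are irrelevant throughout.\<close>

definition representation ::
  "('v, 'e) pre_digraph \<Rightarrow> ('e \<Rightarrow> 'a) \<Rightarrow> 'v set set \<Rightarrow>
   'u star_algebra \<Rightarrow> ('v set \<Rightarrow> 'u) \<Rightarrow> ('a \<Rightarrow> 'u) \<Rightarrow> bool" where
  "representation G L B X p s \<longleftrightarrow>
     (\<forall>A \<in> B. is_projection X (p A)) \<and>
     (\<forall>a \<in> L ` arcs G. is_partial_isometry X (s a)) \<and>
     p {} = \<zero>\<^bsub>X\<^esub> \<and>
     (\<forall>A \<in> B. \<forall>A' \<in> B. p A \<otimes>\<^bsub>X\<^esub> p A' = p (A \<inter> A')) \<and>
     (\<forall>A \<in> B. \<forall>A' \<in> B. p (A \<union> A') = p A \<oplus>\<^bsub>X\<^esub> p A' \<ominus>\<^bsub>X\<^esub> p (A \<inter> A')) \<and>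
     (\<forall>A \<in> B. \<forall>a \<in> L ` arcs G. p A \<otimes>\<^bsub>X\<^esub> s a = s a \<otimes>\<^bsub>X\<^esub> p (rel_range G L A [a])) \<and>
     (\<forall>a \<in> L ` arcs G. adj X (s a) \<otimes>\<^bsub>X\<^esub> s a = p (word_range G L [a])) \<and>
     (\<forall>a \<in> L ` arcs G. \<forall>b \<in> L ` arcs G. a \<noteq> b \<longrightarrow> adj X (s a) \<otimes>\<^bsub>X\<^esub> s b = \<zero>\<^bsub>X\<^esub>) \<and>
     (\<forall>A \<in> B. finite (out_labels G L A) \<and> out_labels G L A \<noteq> {} \<longrightarrow>
        p A = (\<Oplus>\<^bsub>X\<^esub>a \<in> out_labels G L A.
                 s a \<otimes>\<^bsub>X\<^esub> p (rel_range G L A [a]) \<otimes>\<^bsub>X\<^esub> adj X (s a)))"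

text \<open>
  \<open>C\<close> is C*(G, L, B): it is generated by a representation through which every representation in a
  C*-algebra factors. HOL cannot quantify over all types here, so \<open>C\<close> and the test algebras \<open>X\<close>
  have their carriers inside one type \<open>'u\<close> with at least continuum many elements. This loses
  nothing: the vertices and arcs of a labelled graph are countable, hence \<open>B\<close> has at most continuum
  many elements, and so has every C*-algebra generated by a representation of \<open>(G, L, B)\<close>; it is
  therefore isomorphic to one carried by a subset of \<open>'u\<close>, and every representation lives in the
  C*-subalgebra that it generates.
\<close>

definition is_labelled_space_cstar ::
  "('v, 'e) pre_digraph \<Rightarrow> ('e \<Rightarrow> 'a) \<Rightarrow> 'v set set \<Rightarrow> 'u star_algebra \<Rightarrow> bool" where
  "is_labelled_space_cstar G L B C \<longleftrightarrow>
     (UNIV :: real set) \<lesssim> (UNIV :: 'u set) \<and>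
     cstar_algebra C \<and>
     (\<exists>p s. representation G L B C p s \<and>
        generates C (p ` B \<union> s ` L ` arcs G) \<and>
        (\<forall>(X :: 'u star_algebra) q t. cstar_algebra X \<and> representation G L B X q t \<longrightarrow>
           (\<exists>f. star_hom C X f \<and>
              (\<forall>A \<in> B. f (p A) = q A) \<and> (\<forall>a \<in> L ` arcs G. f (s a) = t a))))"

end

theory Submission
  imports Defs "HOL-Analysis.Urysohn"
begin

text \<open>
  Passing to the merged graph changes neither the Boolean algebra of admissible vertex sets nor the
  action of the labels on it, and the C*-algebra of a labelled space depends on nothing else.

  Two vertices are identified in the merged graph iff they receive exactly the same words
  (\<open>inf_class_iff\<close>). Call a vertex set saturated if it is a union of identification classes.
  Saturated sets correspond bijectively to sets of merged vertices, by \<open>A \<mapsto> inf_class E L ` A\<close> with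
  inverse \<open>Y \<mapsto> \<Union>Y\<close>. Generalized vertices and ranges of words are saturated by
  definition, and the correspondence carries them over to the merged graph. The one step that needs
  a hypothesis is that the relative range of a saturated set is saturated. Weak left-resolvingness
  gives it: if \<open>v\<close> and \<open>v'\<close> receive the same words, then so do the sources of a \<open>w\<close>-labelled path to
  \<open>v\<close> and of one to \<open>v'\<close> (\<open>in_word_range_transfer\<close>). By minimality of \<^const>\<open>bar_family\<close> on either side, the
  correspondence restricts to a bijection between the two families, compatible with all data that
  occur in the relations of a representation. So a representation of one labelled space is a
  representation of the other after reindexing the projections.

  A singleton of merged vertices corresponds to a class \<open>inf_class E L v\<close>. The generalized vertices of
  \<open>v\<close> decrease to this class, and they become stationary since one of them is finite; so the
  class is itself a generalized vertex.

  The two universal properties now provide *-homomorphisms in both directions whose composites fix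
  the generators. That these composites are identities requires *-homomorphisms to be continuous.
  This is shown without spectral theory (\<open>star_hom_bounded\<close>): a self-adjoint \<open>a\<close> of small norm is the
  real part of the unitary \<open>a + \<i> sqrt (1 - a\<^sup>2)\<close>, and unitaries go to unitaries, which have norm one.
  As algebras need not have a unit, the argument is carried out with
  \<open>d = 1 - sqrt (1 - a\<^sup>2)\<close>, which solves \<open>2 d = a\<^sup>2 + d\<^sup>2\<close> and is found by contraction.
\<close>

section \<open>Elementary facts on C*-algebras\<close>

context cstar_algebra
begin

lemma smult_carrier [simp, intro]: "x \<in> carrier A \<Longrightarrow> c \<odot> x \<in> carrier A"
  using smult_closed[of c x] by (simp add: complex_ring_def)

lemma smult_add_scalar: "x \<in> carrier A \<Longrightarrow> (c + d) \<odot> x = c \<odot> x \<oplus> d \<odot> x"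
  using smult_l_distr[of c d x] by (simp add: complex_ring_def)

lemma smult_add: "\<lbrakk>x \<in> carrier A; y \<in> carrier A\<rbrakk> \<Longrightarrow> c \<odot> (x \<oplus> y) = c \<odot> x \<oplus> c \<odot> y"
  using smult_r_distr[of c x y] by (simp add: complex_ring_def)

lemma smult_smult: "x \<in> carrier A \<Longrightarrow> c \<odot> (d \<odot> x) = (c * d) \<odot> x"
  using smult_assoc1[of c d x] by (simp add: complex_ring_def)

lemma smult_1: "x \<in> carrier A \<Longrightarrow> 1 \<odot> x = x"
  using smult_one[of x] by (simp add: complex_ring_def)

lemma smult_0: "x \<in> carrier A \<Longrightarrow> 0 \<odot> x = \<zero>"
  using smult_l_null[of x] by (simp add: complex_ring_def)

lemma smult_zero: "c \<odot> \<zero> = \<zero>"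
  using smult_r_null[of c] by (simp add: complex_ring_def)

lemma uminus_conv_smult:
  assumes "x \<in> carrier A"
  shows "\<ominus> x = (-1) \<odot> x"
proof -
  have "(-1) \<odot> x \<oplus> x = (-1 + 1) \<odot> x"
    using assms by (simp only: smult_add_scalar smult_1)
  then show ?thesis
    using assms minus_equality[of "(-1) \<odot> x" x] by (simp add: smult_0)
qed

lemma minus_conv_smult: "\<lbrakk>x \<in> carrier A; y \<in> carrier A\<rbrakk> \<Longrightarrow> x \<ominus> y = x \<oplus> (-1) \<odot> y"
  by (simp add: a_minus_def uminus_conv_smult)

lemma nrm_zero [simp]: "nrm A \<zero> = 0"
  by (simp add: nrm_eq_0)

lemma nrm_minus_commute:
  assumes "x \<in> carrier A" "y \<in> carrier A"
  shows "nrm A (x \<ominus> y) = nrm A (y \<ominus> x)"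
proof -
  have "(-1) \<odot> (x \<ominus> y) = y \<ominus> x"
    using assms by (simp add: minus_conv_smult smult_add smult_smult smult_1 a_comm)
  then show ?thesis
    using assms nrm_smult[of "x \<ominus> y" "-1"] by simp
qed

lemma nrm_minus_triangle:
  assumes "x \<in> carrier A" "y \<in> carrier A" "z \<in> carrier A"
  shows "nrm A (x \<ominus> z) \<le> nrm A (x \<ominus> y) + nrm A (y \<ominus> z)"
proof -
  have "x \<ominus> z = (x \<ominus> y) \<oplus> (y \<ominus> z)"
    using assms by (simp add: a_minus_def a_assoc r_neg1)
  then show ?thesis
    using assms by (simp add: nrm_triangle)
qed

lemma nrm_minus_le: "\<lbrakk>x \<in> carrier A; y \<in> carrier A\<rbrakk> \<Longrightarrow> nrm A (x \<ominus> y) \<le> nrm A x + nrm A y"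
  using nrm_triangle[of x "(-1) \<odot> y"] nrm_smult[of y "-1"] by (simp add: minus_conv_smult)

lemma minus_eq_zero_iff:
  assumes "x \<in> carrier A" "y \<in> carrier A"
  shows "x \<ominus> y = \<zero> \<longleftrightarrow> x = y"
proof
  assume "x \<ominus> y = \<zero>"
  moreover have "x = (x \<ominus> y) \<oplus> y"
    using assms by (simp add: a_minus_def a_assoc l_neg)
  ultimately show "x = y" using assms by simp
qed (use assms in \<open>simp add: a_minus_def r_neg\<close>)

lemma add_minus_add:
  assumes "x \<in> carrier A" "y \<in> carrier A" "z \<in> carrier A"
  shows "(x \<oplus> y) \<ominus> (x \<oplus> z) = y \<ominus> z"
proof -
  have "(x \<oplus> y) \<ominus> (x \<oplus> z) = (x \<oplus> \<ominus> x) \<oplus> (y \<ominus> z)"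
    unfolding a_minus_def minus_add[OF assms(1,3)] using assms by (simp add: a_ac)
  then show ?thesis using assms by (simp add: r_neg)
qed

lemma nrm_minus_eq_0: "\<lbrakk>x \<in> carrier A; y \<in> carrier A\<rbrakk> \<Longrightarrow> nrm A (x \<ominus> y) = 0 \<longleftrightarrow> x = y"
  by (simp add: nrm_eq_0 minus_eq_zero_iff)

lemma nrm_adj:
  assumes "x \<in> carrier A"
  shows "nrm A (adj A x) = nrm A x"
proof -
  have le: "nrm A y \<le> nrm A (adj A y)" if "y \<in> carrier A" for y
  proof -
    have "nrm A y * nrm A y \<le> nrm A (adj A y) * nrm A y"
      using that cstar_identity[of y] nrm_mult[of "adj A y" y] adj_closed[of y]
      by (simp add: power2_eq_square)
    then show ?thesis
      using nrm_nonneg[OF that] nrm_nonneg[OF adj_closed[OF that]]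
      by (cases "nrm A y = 0") auto
  qed
  from le[OF assms] le[OF adj_closed[OF assms]] assms show ?thesis
    by (simp add: adj_adj)
qed

lemma adj_minus: "\<lbrakk>x \<in> carrier A; y \<in> carrier A\<rbrakk> \<Longrightarrow> adj A (x \<ominus> y) = adj A x \<ominus> adj A y"
  by (simp add: minus_conv_smult adj_add adj_smult adj_closed)

lemma mult_minus_left:
  "\<lbrakk>x \<in> carrier A; y \<in> carrier A; z \<in> carrier A\<rbrakk> \<Longrightarrow> (x \<ominus> y) \<otimes> z = x \<otimes> z \<ominus> y \<otimes> z"
  by (simp add: minus_conv_smult distrib_right smult_mult_left mult_closed)

lemma mult_minus_right:
  "\<lbrakk>x \<in> carrier A; y \<in> carrier A; z \<in> carrier A\<rbrakk> \<Longrightarrow> z \<otimes> (x \<ominus> y) = z \<otimes> x \<ominus> z \<otimes> y"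
  by (simp add: minus_conv_smult distrib_left smult_mult_right mult_closed)

lemma mult_zero_left: "x \<in> carrier A \<Longrightarrow> \<zero> \<otimes> x = \<zero>"
  using smult_mult_left[of \<zero> x 0] by (simp add: smult_0 mult_closed)

lemma mult_zero_right: "x \<in> carrier A \<Longrightarrow> x \<otimes> \<zero> = \<zero>"
  using smult_mult_right[of x \<zero> 0] by (simp add: smult_0 mult_closed)

lemma adj_zero: "adj A \<zero> = \<zero>"
  using adj_smult[of \<zero> 0] by (simp add: smult_0 adj_closed)

lemma metric: "Metric_space (carrier A) (nrm_dist A)"
proof
  fix x y
  show "0 \<le> nrm_dist A x y"
    by (simp add: nrm_dist_def nrm_nonneg)
  show "nrm_dist A x y = nrm_dist A y x"
    by (simp add: nrm_dist_def nrm_minus_commute)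
next
  fix x y assume "x \<in> carrier A" "y \<in> carrier A"
  then show "nrm_dist A x y = 0 \<longleftrightarrow> x = y"
    by (simp add: nrm_dist_def nrm_minus_eq_0)
next
  fix x y z assume "x \<in> carrier A" "y \<in> carrier A" "z \<in> carrier A"
  then show "nrm_dist A x z \<le> nrm_dist A x y + nrm_dist A y z"
    by (simp add: nrm_dist_def nrm_minus_triangle)
qed

sublocale metric: Metric_space "carrier A" "nrm_dist A"
  by (rule metric)

end

section \<open>Continuity of *-homomorphisms\<close>

text \<open>
  Used both to see that algebraic identities in one variable survive limits and to compare two
  *-homomorphisms.
\<close>

lemma closedin_equalizer:
  assumes "cstar_algebra A" "cstar_algebra B"
    and f: "f \<in> carrier A \<rightarrow> carrier B"
    and g: "g \<in> carrier A \<rightarrow> carrier B"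
    and lip_f: "\<And>x y. \<lbrakk>x \<in> carrier A; y \<in> carrier A\<rbrakk> \<Longrightarrow>
      nrm B (f x \<ominus>\<^bsub>B\<^esub> f y) \<le> K * nrm A (x \<ominus>\<^bsub>A\<^esub> y)"
    and lip_g: "\<And>x y. \<lbrakk>x \<in> carrier A; y \<in> carrier A\<rbrakk> \<Longrightarrow>
      nrm B (g x \<ominus>\<^bsub>B\<^esub> g y) \<le> K * nrm A (x \<ominus>\<^bsub>A\<^esub> y)"
  shows "closedin (Metric_space.mtopology (carrier A) (nrm_dist A)) {x \<in> carrier A. f x = g x}"
proof -
  interpret A: cstar_algebra A by fact
  interpret B: cstar_algebra B by fact
  show ?thesis
    unfolding A.metric.closedin_metric
  proof (intro conjI allI impI)
    fix x assume "x \<in> carrier A - {x \<in> carrier A. f x = g x}"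
    then have x: "x \<in> carrier A" and ne: "f x \<noteq> g x" by auto
    have fg: "f y \<in> carrier B" "g y \<in> carrier B" if "y \<in> carrier A" for y
      using f g that by auto
    \<comment> \<open>a point of the equalizer within distance \<open>r\<close> of \<open>x\<close> would move both values by too little\<close>
    define r where "r = nrm B (f x \<ominus>\<^bsub>B\<^esub> g x) / (2 * \<bar>K\<bar> + 1)"
    have "nrm B (f x \<ominus>\<^bsub>B\<^esub> g x) > 0"
      using ne x fg B.nrm_nonneg[of "f x \<ominus>\<^bsub>B\<^esub> g x"] B.nrm_minus_eq_0[of "f x" "g x"] by fastforce
    then have "r > 0" by (simp add: r_def)
    moreover have "disjnt {x \<in> carrier A. f x = g x} (A.metric.mball x r)"
    proof (rule ccontr)
      assume "\<not> ?thesis"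
      then obtain y where y: "y \<in> carrier A" "f y = g y" "nrm A (x \<ominus>\<^bsub>A\<^esub> y) < r"
        by (auto simp: disjnt_iff A.metric.in_mball nrm_dist_def)
      have "nrm B (f x \<ominus>\<^bsub>B\<^esub> g x) \<le> nrm B (f x \<ominus>\<^bsub>B\<^esub> f y) + nrm B (g y \<ominus>\<^bsub>B\<^esub> g x)"
        using B.nrm_minus_triangle[of "f x" "f y" "g x"] x y fg by simp
      also have "\<dots> \<le> 2 * (K * nrm A (x \<ominus>\<^bsub>A\<^esub> y))"
        using lip_f[OF x y(1)] lip_g[OF x y(1)] x y fg by (simp add: B.nrm_minus_commute)
      also have "\<dots> \<le> 2 * (\<bar>K\<bar> * nrm A (x \<ominus>\<^bsub>A\<^esub> y))"
        using A.nrm_nonneg[of "x \<ominus>\<^bsub>A\<^esub> y"] x y by (simp add: mult_right_mono)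
      also have "\<dots> \<le> 2 * (\<bar>K\<bar> * r)"
        using y by (simp add: mult_left_mono)
      also have "\<dots> < (2 * \<bar>K\<bar> + 1) * r"
        using \<open>r > 0\<close> by (simp add: algebra_simps)
      also have "\<dots> = nrm B (f x \<ominus>\<^bsub>B\<^esub> g x)"
        by (simp add: r_def)
      finally show False by simp
    qed
    ultimately show "\<exists>r>0. disjnt {x \<in> carrier A. f x = g x} (A.metric.mball x r)"
      by blast
  qed auto
qed

text \<open>
  The element \<open>d\<close> plays the role of \<open>1 - sqrt (1 - a\<^sup>2)\<close>. It is the fixed point of
  \<open>x \<mapsto> (a\<^sup>2 + x\<^sup>2) / 2\<close>, which has Lipschitz constant \<open>1/2\<close> on the ball of radius \<open>1/2\<close>.
  Being self-adjoint and commuting with \<open>a\<close> are closed conditions that the map preserves, so the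
  iteration can be confined to the set \<open>T\<close> of elements satisfying them.
\<close>

lemma (in cstar_algebra) selfadjoint_commuting_root:
  assumes a: "a \<in> carrier A" "adj A a = a" "nrm A a \<le> 1/2"
  obtains d where "d \<in> carrier A" "adj A d = d" "a \<otimes> d = d \<otimes> a"
    "d \<oplus> d = a \<otimes> a \<oplus> d \<otimes> d"
proof -
  have A: "cstar_algebra A" by unfold_locales
  define T where "T = {x \<in> carrier A. adj A x = x} \<inter> {x \<in> carrier A. a \<otimes> x = x \<otimes> a}
    \<inter> metric.mcball \<zero> (1/2)"
  have T_iff: "x \<in> T \<longleftrightarrow> x \<in> carrier A \<and> adj A x = x \<and> a \<otimes> x = x \<otimes> a \<and> nrm A x \<le> 1/2" for x
    using nrm_minus_commute[of \<zero> x]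
    by (auto simp: T_def nrm_dist_def minus_conv_smult smult_zero)
  have closed: "closedin metric.mtopology T"
    unfolding T_def
  proof (intro closedin_Int metric.closedin_mcball)
    show "closedin metric.mtopology {x \<in> carrier A. adj A x = x}"
      by (rule closedin_equalizer[OF A A, where K = 1])
        (auto simp: adj_closed nrm_adj simp flip: adj_minus)
    show "closedin metric.mtopology {x \<in> carrier A. a \<otimes> x = x \<otimes> a}"
    proof (rule closedin_equalizer[OF A A, where K = "nrm A a"])
      fix x y assume xy: "x \<in> carrier A" "y \<in> carrier A"
      show "nrm A (a \<otimes> x \<ominus> a \<otimes> y) \<le> nrm A a * nrm A (x \<ominus> y)"
        using xy a nrm_mult[of a "x \<ominus> y"] by (simp add: mult_minus_right)
      show "nrm A (x \<otimes> a \<ominus> y \<otimes> a) \<le> nrm A a * nrm A (x \<ominus> y)"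
        using xy a nrm_mult[of "x \<ominus> y" a] by (simp add: mult_minus_left mult.commute)
    qed (use a in \<open>auto simp: mult_closed\<close>)
  qed
  interpret T: Submetric "carrier A" "nrm_dist A" T
    by unfold_locales (auto simp: T_iff)
  have cT: "T.sub.mcomplete"
    using T.closedin_mcomplete_imp_mcomplete[OF closed complete] .
  define F where "F x = (1/2) \<odot> (a \<otimes> a \<oplus> x \<otimes> x)" for x
  have Fc: "F x \<in> carrier A" if "x \<in> carrier A" for x
    using that a by (simp add: F_def mult_closed)
  obtain d where d: "d \<in> T" "F d = d"
  proof (rule T.sub.Banach_fixedpoint_thm[OF cT, of F "1/2"])
    show "T \<noteq> {}"
      using a by (auto simp: T_iff mult_zero_left mult_zero_right adj_zero intro!: exI[of _ \<zero>])
    show "F \<in> T \<rightarrow> T"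
    proof
      fix x assume "x \<in> T"
      then have x: "x \<in> carrier A" "adj A x = x" "a \<otimes> x = x \<otimes> a" "nrm A x \<le> 1/2"
        by (auto simp: T_iff)
      have "nrm A (a \<otimes> a) \<le> (1/2) * (1/2)" "nrm A (x \<otimes> x) \<le> (1/2) * (1/2)"
        using nrm_mult[of a a] nrm_mult[of x x] a x nrm_nonneg[of a] nrm_nonneg[of x]
        by (meson mult_mono order_trans zero_le_divide_1_iff zero_le_numeral)+
      then have "nrm A (F x) \<le> 1/2"
        using nrm_triangle[of "a \<otimes> a" "x \<otimes> x"] a x
        by (simp add: F_def nrm_smult mult_closed)
      moreover have "a \<otimes> (x \<otimes> x) = (x \<otimes> x) \<otimes> a"
        using a x mult_assoc[of a x x] mult_assoc[of x a x] mult_assoc[of x x a] by simp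
      ultimately show "F x \<in> T"
        using a x Fc[of x]
        by (simp add: T_iff F_def adj_smult adj_add adj_mult mult_closed smult_mult_left
            smult_mult_right distrib_left distrib_right mult_assoc)
    qed
    show "nrm_dist A (F x) (F y) \<le> 1/2 * nrm_dist A x y" if xy: "x \<in> T" "y \<in> T" for x y
    proof -
      have x: "x \<in> carrier A" "nrm A x \<le> 1/2" and y: "y \<in> carrier A" "nrm A y \<le> 1/2"
        using xy by (auto simp: T_iff)
      have "F x \<ominus> F y = (1/2) \<odot> (x \<otimes> x \<ominus> y \<otimes> y)"
      proof -
        have "F x \<ominus> F y = (1/2) \<odot> ((a \<otimes> a \<oplus> x \<otimes> x) \<ominus> (a \<otimes> a \<oplus> y \<otimes> y))"
          using a x y by (simp add: F_def minus_conv_smult smult_add smult_smult mult_closed)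
        moreover have "(a \<otimes> a \<oplus> x \<otimes> x) \<ominus> (a \<otimes> a \<oplus> y \<otimes> y) = x \<otimes> x \<ominus> y \<otimes> y"
          using a x y by (simp add: add_minus_add mult_closed)
        ultimately show ?thesis by simp
      qed
      moreover have "x \<otimes> x \<ominus> y \<otimes> y = x \<otimes> (x \<ominus> y) \<oplus> (x \<ominus> y) \<otimes> y"
      proof -
        have "x \<otimes> (x \<ominus> y) \<oplus> (x \<ominus> y) \<otimes> y = (x \<otimes> x \<ominus> x \<otimes> y) \<oplus> (x \<otimes> y \<ominus> y \<otimes> y)"
          using x y by (simp add: mult_minus_left mult_minus_right)
        then show ?thesis
          using x y by (simp add: a_minus_def a_assoc r_neg1 mult_closed)
      qed
      moreover have "nrm A (x \<otimes> (x \<ominus> y)) \<le> 1/2 * nrm A (x \<ominus> y)"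
        using nrm_mult[of x "x \<ominus> y"] x y nrm_nonneg[of "x \<ominus> y"]
        by (meson minus_closed mult_right_mono order_trans)
      moreover have "nrm A ((x \<ominus> y) \<otimes> y) \<le> nrm A (x \<ominus> y) * (1/2)"
        using nrm_mult[of "x \<ominus> y" y] x y nrm_nonneg[of "x \<ominus> y"]
        by (meson minus_closed mult_left_mono order_trans)
      ultimately have "nrm A (F x \<ominus> F y) \<le> 1/2 * nrm A (x \<ominus> y)"
        using nrm_triangle[of "x \<otimes> (x \<ominus> y)" "(x \<ominus> y) \<otimes> y"] x y
        by (simp add: nrm_smult mult_closed)
      then show ?thesis
        using x y Fc by (simp add: nrm_dist_def)
    qed
  qed (use that in auto)
  have dc: "d \<in> carrier A" using d by (simp add: T_iff)
  have "d \<oplus> d = F d \<oplus> F d" using d by simp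
  also have "\<dots> = (1/2 + 1/2) \<odot> (a \<otimes> a \<oplus> d \<otimes> d)"
    using a dc by (simp only: F_def smult_add_scalar mult_closed a_closed)
  also have "\<dots> = a \<otimes> a \<oplus> d \<otimes> d"
    using a dc by (simp add: smult_1 mult_closed)
  finally show thesis
    using that d by (auto simp: T_iff)
qed

text \<open>
  In a unital algebra, \<open>u = b + \<i> (1 - e)\<close> would be unitary and have \<open>b\<close> as its real part. The element
  \<open>z = e + \<i> b\<close> equals \<open>1 + \<i> u\<close>, so that \<open>z* z = z + z*\<close>, which makes sense without a unit and
  bounds the norm of \<open>z\<close> by 2 through the C*-identity.
\<close>

lemma (in cstar_algebra) nrm_le_2_of_root:
  assumes b: "b \<in> carrier A" "adj A b = b" and e: "e \<in> carrier A" "adj A e = e"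
    and comm: "b \<otimes> e = e \<otimes> b" and root: "e \<oplus> e = b \<otimes> b \<oplus> e \<otimes> e"
  shows "nrm A b \<le> 2"
proof -
  define z where "z = e \<oplus> \<i> \<odot> b"
  have z: "z \<in> carrier A" using b e by (simp add: z_def)
  have az: "adj A z = e \<oplus> (- \<i>) \<odot> b"
    using b e by (simp add: z_def adj_add adj_smult)
  have cancel: "\<i> \<odot> x \<oplus> (- \<i>) \<odot> x = \<zero>" "(- \<i>) \<odot> x \<oplus> \<i> \<odot> x = \<zero>" if "x \<in> carrier A" for x
    using that by (simp_all add: smult_0 flip: smult_add_scalar)
  have "adj A z \<otimes> z = (e \<otimes> e \<oplus> (- \<i>) \<odot> (e \<otimes> b)) \<oplus> (\<i> \<odot> (e \<otimes> b) \<oplus> b \<otimes> b)"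
    unfolding az unfolding z_def using b e comm
    by (simp add: distrib_left distrib_right smult_mult_left smult_mult_right mult_closed
        smult_smult smult_add smult_1)
  also have "\<dots> = (e \<otimes> e) \<oplus> (((- \<i>) \<odot> (e \<otimes> b) \<oplus> \<i> \<odot> (e \<otimes> b)) \<oplus> b \<otimes> b)"
    using b e by (simp add: a_assoc mult_closed)
  also have "\<dots> = e \<oplus> e"
    using b e by (simp add: cancel mult_closed root a_comm)
  also have "\<dots> = z \<oplus> adj A z"
  proof -
    have "z \<oplus> adj A z = (e \<oplus> e) \<oplus> (\<i> \<odot> b \<oplus> (- \<i>) \<odot> b)"
      unfolding az unfolding z_def using b e by (simp add: a_ac)
    then show ?thesis using b e by (simp add: cancel)
  qed
  finally have "(nrm A z)\<^sup>2 \<le> 2 * nrm A z"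
    using cstar_identity[OF z] nrm_triangle[OF z adj_closed[OF z]] nrm_adj[OF z] by simp
  then have z2: "nrm A z \<le> 2"
    using nrm_nonneg[OF z] by (cases "nrm A z = 0") (auto simp: power2_eq_square)
  have "z \<ominus> adj A z = (2 * \<i>) \<odot> b"
  proof -
    have "z \<ominus> adj A z = (e \<oplus> (-1) \<odot> e) \<oplus> (\<i> \<odot> b \<oplus> \<i> \<odot> b)"
      unfolding az unfolding z_def using b e
      by (simp add: minus_conv_smult smult_add smult_smult a_ac)
    moreover have "e \<oplus> (-1) \<odot> e = \<zero>"
      using e by (simp add: r_neg flip: uminus_conv_smult)
    moreover have "\<i> \<odot> b \<oplus> \<i> \<odot> b = (2 * \<i>) \<odot> b"
      using b by (simp flip: smult_add_scalar)
    ultimately show ?thesis using b by simp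
  qed
  then have "2 * nrm A b \<le> 2 * nrm A z"
    using nrm_minus_le[OF z adj_closed[OF z]] nrm_adj[OF z] b
    by (simp add: nrm_smult norm_mult)
  then show ?thesis using z2 by simp
qed

text \<open>
  The equations of the two preceding lemmas are preserved by \<open>f\<close>, and the second lemma turns them into
  a bound in \<open>B\<close>. This treats self-adjoint elements; the C*-identity reduces the general case to
  \<open>x* x\<close>.
\<close>

lemma star_hom_bounded:
  assumes "cstar_algebra A" "cstar_algebra B" and f: "star_hom A B f" and x: "x \<in> carrier A"
  shows "nrm B (f x) \<le> 2 * nrm A x"
proof -
  interpret A: cstar_algebra A by fact
  interpret B: cstar_algebra B by fact
  have fc: "f y \<in> carrier B" if "y \<in> carrier A" for y
    using f that by (auto simp: star_hom_def)
  have f_add: "f (y \<oplus>\<^bsub>A\<^esub> z) = f y \<oplus>\<^bsub>B\<^esub> f z" "f (y \<otimes>\<^bsub>A\<^esub> z) = f y \<otimes>\<^bsub>B\<^esub> f z"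
    if "y \<in> carrier A" "z \<in> carrier A" for y z
    using f that by (auto simp: star_hom_def)
  have f_smult: "f (c \<odot>\<^bsub>A\<^esub> y) = c \<odot>\<^bsub>B\<^esub> f y" and f_adj: "f (adj A y) = adj B (f y)"
    if "y \<in> carrier A" for y c
    using f that by (auto simp: star_hom_def)
  have small: "nrm B (f a) \<le> 2" if a: "a \<in> carrier A" "adj A a = a" "nrm A a \<le> 1/2" for a
  proof -
    obtain d where "d \<in> carrier A" "adj A d = d" "a \<otimes>\<^bsub>A\<^esub> d = d \<otimes>\<^bsub>A\<^esub> a"
      "d \<oplus>\<^bsub>A\<^esub> d = a \<otimes>\<^bsub>A\<^esub> a \<oplus>\<^bsub>A\<^esub> d \<otimes>\<^bsub>A\<^esub> d"
      using A.selfadjoint_commuting_root[OF a] .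
    with a show ?thesis
      using B.nrm_le_2_of_root[of "f a" "f d"] fc f_add f_adj A.mult_closed by metis
  qed
  have sa: "nrm B (f a) \<le> 4 * nrm A a" if a: "a \<in> carrier A" "adj A a = a" for a
  proof (cases "nrm A a = 0")
    case True
    then have "a = 0 \<odot>\<^bsub>A\<^esub> a" using a by (simp add: A.nrm_eq_0 A.smult_0)
    then have "f a = \<zero>\<^bsub>B\<^esub>" using a f_smult[of a 0] fc[of a] by (simp add: B.smult_0)
    then show ?thesis using True by simp
  next
    case False
    \<comment> \<open>scaling to norm \<open>1/2\<close>, where \<open>small\<close> applies\<close>
    define t where "t = 1 / (2 * nrm A a)"
    have pos: "nrm A a > 0" using False A.nrm_nonneg[OF a(1)] by simp
    have "nrm B (f (complex_of_real t \<odot>\<^bsub>A\<^esub> a)) \<le> 2"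
      by (rule small) (use a pos in \<open>auto simp: A.nrm_smult A.adj_smult t_def norm_divide norm_mult\<close>)
    then show ?thesis
      using a pos fc by (simp add: f_smult B.nrm_smult t_def field_simps norm_divide norm_mult)
  qed
  have ax: "adj A x \<in> carrier A" "adj A x \<otimes>\<^bsub>A\<^esub> x \<in> carrier A"
    using x by (auto simp: A.adj_closed A.mult_closed)
  have "(nrm B (f x))\<^sup>2 = nrm B (f (adj A x \<otimes>\<^bsub>A\<^esub> x))"
    using x ax by (simp add: f_add f_adj fc B.cstar_identity)
  also have "\<dots> \<le> 4 * nrm A (adj A x \<otimes>\<^bsub>A\<^esub> x)"
    using x ax by (intro sa) (auto simp: A.adj_mult A.adj_adj)
  also have "\<dots> = (2 * nrm A x)\<^sup>2"
    using x by (simp add: A.cstar_identity power_mult_distrib)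
  finally have le: "(nrm B (f x))\<^sup>2 \<le> (2 * nrm A x)\<^sup>2" .
  show ?thesis
    by (rule power2_le_imp_le[OF le]) (simp add: A.nrm_nonneg[OF x])
qed

lemma star_hom_comp:
  "star_hom A B f \<Longrightarrow> star_hom B C g \<Longrightarrow> star_hom A C (g \<circ> f)"
  by (auto simp: star_hom_def Pi_iff)

lemma star_hom_id: "star_hom A A id"
  by (auto simp: star_hom_def)

text \<open>
  By continuity the set on which two *-homomorphisms agree is a closed *-subalgebra.
\<close>

lemma star_hom_eq_on_generators:
  assumes cA: "cstar_algebra A" and cB: "cstar_algebra B"
    and f: "star_hom A B f" and g: "star_hom A B g"
    and gen: "generates A S" and eq: "\<And>x. x \<in> S \<Longrightarrow> f x = g x"
    and x: "x \<in> carrier A"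
  shows "f x = g x"
proof -
  interpret A: cstar_algebra A by fact
  interpret B: cstar_algebra B by fact
  have lip: "nrm B (h y \<ominus>\<^bsub>B\<^esub> h z) \<le> 2 * nrm A (y \<ominus>\<^bsub>A\<^esub> z)"
    if h: "star_hom A B h" and yz: "y \<in> carrier A" "z \<in> carrier A" for h y z
  proof -
    have "h (y \<ominus>\<^bsub>A\<^esub> z) = h y \<ominus>\<^bsub>B\<^esub> h z"
      using h yz by (auto simp: star_hom_def A.minus_conv_smult B.minus_conv_smult Pi_iff)
    then show ?thesis using star_hom_bounded[OF cA cB h, of "y \<ominus>\<^bsub>A\<^esub> z"] yz by simp
  qed
  have zero: "h \<zero>\<^bsub>A\<^esub> = \<zero>\<^bsub>B\<^esub>" if h: "star_hom A B h" for h
  proof -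
    have "h (0 \<odot>\<^bsub>A\<^esub> \<zero>\<^bsub>A\<^esub>) = 0 \<odot>\<^bsub>B\<^esub> h \<zero>\<^bsub>A\<^esub>" and "h \<zero>\<^bsub>A\<^esub> \<in> carrier B"
      using h by (auto simp: star_hom_def)
    then show ?thesis by (simp add: A.smult_0 B.smult_0)
  qed
  define T where "T = {x \<in> carrier A. f x = g x}"
  have "cstar_subalgebra A T"
    unfolding cstar_subalgebra_def
  proof (intro conjI)
    show "closedin A.metric.mtopology T"
      unfolding T_def
      by (rule closedin_equalizer[OF cA cB, where K = 2])
        (use f g lip in \<open>auto simp: star_hom_def\<close>)
    show "\<zero>\<^bsub>A\<^esub> \<in> T"
      using zero[OF f] zero[OF g] by (simp add: T_def)
  qed (use f g in \<open>auto simp: T_def star_hom_def A.mult_closed A.adj_closed\<close>)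
  moreover have "S \<subseteq> T"
    using gen eq by (auto simp: T_def generates_def)
  ultimately have "T = carrier A"
    using gen by (auto simp: generates_def)
  then show ?thesis using x by (auto simp: T_def)
qed

section \<open>Words and ranges\<close>


lemma rel_range_Nil [simp]: "rel_range G L A [] = {}"
  by (auto simp: rel_range_def)

lemma rel_range_mono: "A \<subseteq> A' \<Longrightarrow> rel_range G L A w \<subseteq> rel_range G L A' w"
  by (auto simp: rel_range_def)

lemma rel_range_subset_word_range: "rel_range G L A w \<subseteq> word_range G L w"
  by (auto simp: rel_range_def word_range_def)

lemma rel_range_singleton_source:
  "v \<in> rel_range G L A w \<longleftrightarrow> (\<exists>u \<in> A. v \<in> rel_range G L {u} w)"
  by (auto simp: rel_range_def)

lemma label_words_iff: "w \<in> label_words G L \<longleftrightarrow> word_range G L w \<noteq> {}"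
  by (auto simp: label_words_def word_range_def)

context wf_digraph
begin

lemma word_range_conv_rel_range: "word_range G L w = rel_range G L (verts G) w"
  by (auto simp: rel_range_def word_range_def awalk_def)

lemma word_range_subset_verts: "word_range G L w \<subseteq> verts G"
  by (auto simp: word_range_def)

lemma rel_range_subset_verts: "rel_range G L A w \<subseteq> verts G"
  by (rule order_trans[OF rel_range_subset_word_range word_range_subset_verts])

lemma source_in_verts: "v \<in> rel_range G L {u} w \<Longrightarrow> u \<in> verts G"
  by (auto simp: rel_range_def awalk_def)

lemma rel_range_letter:
  "rel_range G L A [a] = head G ` {e \<in> arcs G. tail G e \<in> A \<and> L e = a}"
proof (intro Set.set_eqI iffI)
  fix v assume "v \<in> rel_range G L A [a]"
  then obtain q u where "awalk u q v" "map L q = [a]" "u \<in> A"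
    by (auto simp: rel_range_def)
  then show "v \<in> head G ` {e \<in> arcs G. tail G e \<in> A \<and> L e = a}"
    by (auto simp: awalk_simps)
next
  fix v assume "v \<in> head G ` {e \<in> arcs G. tail G e \<in> A \<and> L e = a}"
  then obtain e where e: "e \<in> arcs G" "tail G e \<in> A" "L e = a" "v = head G e"
    by auto
  then have "awalk (tail G e) [e] v"
    by (simp add: arc_implies_awalk)
  with e show "v \<in> rel_range G L A [a]"
    unfolding rel_range_def by (intro CollectI exI[of _ "[e]"] exI[of _ "tail G e"]) auto
qed

lemma rel_range_append:
  assumes "w \<noteq> []" "w' \<noteq> []"
  shows "rel_range G L A (w @ w') = rel_range G L (rel_range G L A w) w'"
proof (intro Set.set_eqI iffI)
  fix v assume "v \<in> rel_range G L A (w @ w')"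
  then obtain q u where q: "awalk u q v" "map L q = w @ w'" "u \<in> A"
    by (auto simp: rel_range_def)
  then obtain q1 q2 where "q = q1 @ q2" "map L q1 = w" "map L q2 = w'"
    by (auto simp: map_eq_append_conv)
  moreover from this q have "awalk u q1 (awlast u q1)" "awalk (awlast u q1) q2 v"
    by auto
  ultimately have "awlast u q1 \<in> rel_range G L A w"
    using q assms by (auto simp: rel_range_def)
  then show "v \<in> rel_range G L (rel_range G L A w) w'"
    using \<open>map L q2 = w'\<close> \<open>awalk (awlast u q1) q2 v\<close> assms
    by (auto simp: rel_range_def[of G L "rel_range G L A w"])
next
  fix v assume "v \<in> rel_range G L (rel_range G L A w) w'"
  then obtain u q1 m q2 where "awalk u q1 m" "map L q1 = w" "u \<in> A" "awalk m q2 v" "map L q2 = w'"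
    by (auto simp: rel_range_def)
  then show "v \<in> rel_range G L A (w @ w')"
    using assms unfolding rel_range_def
    by (intro CollectI exI[of _ "q1 @ q2"] exI[of _ u])
       (auto intro: awalk_appendI)
qed

lemma word_range_append:
  "w \<noteq> [] \<Longrightarrow> w' \<noteq> [] \<Longrightarrow> word_range G L (w @ w') = rel_range G L (word_range G L w) w'"
  by (simp add: word_range_conv_rel_range rel_range_append)

end

section \<open>Identification classes of vertices\<close>

lemma in_words_iff: "w \<in> in_words G L l v \<longleftrightarrow> length w \<le> l \<and> v \<in> word_range G L w"
  unfolding in_words_def word_range_def by (auto simp: Suc_le_eq)

lemma gen_vertex_iff:
  "w \<in> gen_vertex G L l v \<longleftrightarrow>
     w \<in> verts G \<and> (\<forall>x. length x \<le> l \<longrightarrow> (w \<in> word_range G L x \<longleftrightarrow> v \<in> word_range G L x))"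
  unfolding gen_vertex_def set_eq_iff in_words_iff by auto

lemma gen_vertex_antimono: "l \<le> m \<Longrightarrow> gen_vertex G L m v \<subseteq> gen_vertex G L l v"
  by (auto simp: gen_vertex_iff)

lemma inf_class_iff:
  fixes L :: "'e \<Rightarrow> 'a"
  assumes "v \<in> verts G"
  shows "w \<in> inf_class G L v \<longleftrightarrow>
    w \<in> verts G \<and> (\<forall>x. w \<in> word_range G L x \<longleftrightarrow> v \<in> word_range G L x)"
proof
  assume w: "w \<in> inf_class G L v"
  then have wv: "w \<in> verts G" by (simp add: inf_class_def)
  have "w \<in> word_range G L x \<longleftrightarrow> v \<in> word_range G L x" for x
  proof -
    \<comment> \<open>levels start at 1, while \<open>x\<close> may be empty\<close>
    have "w \<in> gen_vertex G L (Suc (length x)) w"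
      using wv by (simp add: gen_vertex_iff)
    then have "w \<in> gen_vertex G L (Suc (length x)) v"
      using w by (simp add: inf_class_def)
    then show ?thesis
      by (simp add: gen_vertex_iff)
  qed
  with wv show "w \<in> verts G \<and> (\<forall>x. w \<in> word_range G L x \<longleftrightarrow> v \<in> word_range G L x)"
    by blast
next
  assume "w \<in> verts G \<and> (\<forall>x. w \<in> word_range G L x \<longleftrightarrow> v \<in> word_range G L x)"
  then show "w \<in> inf_class G L v"
    by (auto simp: inf_class_def gen_vertex_iff)
qed

lemma inf_class_subset_gen_vertex:
  "v \<in> verts G \<Longrightarrow> inf_class G L v \<subseteq> gen_vertex G L l v"
  by (auto simp: inf_class_iff gen_vertex_iff)

lemma inf_class_self: "v \<in> verts G \<Longrightarrow> v \<in> inf_class G L v"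
  by (simp add: inf_class_iff)

lemma inf_class_eq_iff:
  "\<lbrakk>v \<in> verts G; w \<in> verts G\<rbrakk> \<Longrightarrow> inf_class G L w = inf_class G L v \<longleftrightarrow> w \<in> inf_class G L v"
  unfolding set_eq_iff inf_class_iff by blast

text \<open>
  The sets \<open>gen_vertex G L k v\<close> decrease in \<open>k\<close> with intersection \<open>inf_class G L v\<close>. Once they are finite,
  the one of least cardinality is contained in all others.
\<close>

lemma inf_class_eq_gen_vertex:
  assumes v: "v \<in> verts G" and l: "finite (gen_vertex G L l v)"
  obtains m where "m \<ge> 1" "inf_class G L v = gen_vertex G L m v"
proof -
  obtain m where m: "m \<ge> Suc l"
    and min: "\<And>k. k \<ge> Suc l \<Longrightarrow> card (gen_vertex G L m v) \<le> card (gen_vertex G L k v)"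
    using ex_has_least_nat[of "\<lambda>k. k \<ge> Suc l" "Suc l" "\<lambda>k. card (gen_vertex G L k v)"] by auto
  have fin: "finite (gen_vertex G L m v)"
    using m gen_vertex_antimono[of l m G L v] l finite_subset by auto
  have "gen_vertex G L m v \<subseteq> gen_vertex G L k v" for k
  proof -
    have "gen_vertex G L (max m k) v = gen_vertex G L m v"
      using m by (intro card_seteq fin gen_vertex_antimono min) auto
    then show ?thesis
      using gen_vertex_antimono[of k "max m k" G L v] by simp
  qed
  then have "gen_vertex G L m v \<subseteq> inf_class G L v"
    using v unfolding inf_class_iff[OF v] subset_iff gen_vertex_iff by blast
  with that[of m] show thesis
    using m inf_class_subset_gen_vertex[OF v, of L m] by auto
qed

text \<open>
  The closure conditions whose least solution is \<^const>\<open>bar_family\<close>; the minimality then acts as an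
  induction principle.
\<close>

definition bar_closed :: "('v, 'e) pre_digraph \<Rightarrow> ('e \<Rightarrow> 'a) \<Rightarrow> 'v set set \<Rightarrow> bool" where
  "bar_closed G L B \<longleftrightarrow> accommodating G L B \<and>
     (\<forall>A \<in> B. \<forall>A' \<in> B. A - A' \<in> B) \<and>
     (\<forall>v \<in> verts G. \<forall>l \<ge> 1. gen_vertex G L l v \<in> B)"

lemma bar_family_least: "bar_closed G L B \<Longrightarrow> bar_family G L \<subseteq> B"
  unfolding bar_family_def bar_closed_def by blast

lemma bar_closed_bar_family:
  assumes "wf_digraph G"
  shows "bar_closed G L (bar_family G L)"
proof -
  interpret wf_digraph G by fact
  have "bar_closed G L (Pow (verts G))"
    using word_range_subset_verts rel_range_subset_verts
    by (auto simp: bar_closed_def accommodating_def gen_vertex_def) blast+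
  then have "bar_family G L \<subseteq> Pow (verts G)"
    by (rule bar_family_least)
  then show ?thesis
    unfolding bar_closed_def accommodating_def
    by (intro conjI) (auto simp: bar_family_def accommodating_def)
qed

section \<open>Saturated sets\<close>

definition saturated :: "('v, 'e) pre_digraph \<Rightarrow> ('e \<Rightarrow> 'a) \<Rightarrow> 'v set \<Rightarrow> bool" where
  "saturated G L A \<longleftrightarrow> A \<subseteq> verts G \<and> (\<forall>v \<in> A. inf_class G L v \<subseteq> A)"

lemma inf_class_mem_image_iff:
  assumes "saturated G L A" "v \<in> verts G"
  shows "inf_class G L v \<in> inf_class G L ` A \<longleftrightarrow> v \<in> A"
proof
  assume "inf_class G L v \<in> inf_class G L ` A"
  then obtain w where "w \<in> A" "inf_class G L v = inf_class G L w" by auto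
  then show "v \<in> A"
    using assms inf_class_self[of v G L] by (auto simp: saturated_def)
qed auto

lemma Union_inf_class_image: "saturated G L A \<Longrightarrow> \<Union> (inf_class G L ` A) = A"
  using inf_class_self by (fastforce simp: saturated_def)

lemma saturated_Union:
  assumes "Y \<subseteq> inf_class G L ` verts G"
  shows "saturated G L (\<Union>Y)" and "inf_class G L ` \<Union>Y = Y"
proof -
  have cl: "x = inf_class G L v" if xv: "x \<in> Y" "v \<in> x" for x v
  proof -
    obtain u where u: "u \<in> verts G" "x = inf_class G L u" using xv assms by blast
    moreover have "v \<in> verts G" using xv u by (simp add: inf_class_iff)
    ultimately show ?thesis using xv inf_class_eq_iff[of u G v L] by auto
  qed
  have ne: "\<exists>v. v \<in> x" if "x \<in> Y" for x
    using that assms inf_class_self by fastforce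
  have "\<Union>Y \<subseteq> verts G" using assms by (auto simp: inf_class_def)
  with cl show "saturated G L (\<Union>Y)" unfolding saturated_def by blast
  show "inf_class G L ` \<Union>Y = Y"
  proof
    show "inf_class G L ` \<Union>Y \<subseteq> Y" using cl by blast
    show "Y \<subseteq> inf_class G L ` \<Union>Y"
    proof
      fix x assume x: "x \<in> Y"
      then obtain v where v: "v \<in> x" using ne by blast
      show "x \<in> inf_class G L ` \<Union>Y"
        using cl[OF x v] by (rule image_eqI) (use x v in blast)
    qed
  qed
qed

lemma inf_class_image_Int:
  assumes "saturated G L A" "saturated G L A'"
  shows "inf_class G L ` (A \<inter> A') = inf_class G L ` A \<inter> inf_class G L ` A'"
  using assms inf_class_mem_image_iff[OF assms(2)] by (auto simp: saturated_def)

lemma inf_class_image_Diff: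
  assumes "saturated G L A" "saturated G L A'"
  shows "inf_class G L ` (A - A') = inf_class G L ` A - inf_class G L ` A'"
  using assms inf_class_mem_image_iff[OF assms(2)] by (auto simp: saturated_def)

lemma saturated_word_range:
  assumes "wf_digraph G" shows "saturated G L (word_range G L w)"
  using wf_digraph.word_range_subset_verts[OF assms]
  by (fastforce simp: saturated_def inf_class_iff)

lemma saturated_gen_vertex: "saturated G L (gen_vertex G L l v)"
  by (auto simp: saturated_def gen_vertex_iff inf_class_iff)

lemma saturated_boolean:
  "saturated G L {}" "saturated G L (verts G)"
  "saturated G L A \<Longrightarrow> saturated G L A' \<Longrightarrow> saturated G L (A \<union> A')"
  "saturated G L A \<Longrightarrow> saturated G L A' \<Longrightarrow> saturated G L (A \<inter> A')"
  by (auto simp: saturated_def inf_class_def)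

lemma saturated_Diff:
  assumes "saturated G L A" "saturated G L A'"
  shows "saturated G L (A - A')"
  unfolding saturated_def
proof (intro conjI ballI subsetI)
  fix v w assume v: "v \<in> A - A'" and w: "w \<in> inf_class G L v"
  then have "v \<in> verts G" "w \<in> verts G"
    using assms by (auto simp: saturated_def inf_class_def)
  then have "v \<in> inf_class G L w"
    using w by (simp add: inf_class_iff)
  then show "w \<in> A - A'"
    using assms v w by (auto simp: saturated_def)
qed (use assms in \<open>auto simp: saturated_def\<close>)

lemma
  assumes Y: "Y \<subseteq> inf_class G L ` verts G" and Y': "Y' \<subseteq> inf_class G L ` verts G"
  shows Union_classes_Int: "\<Union> (Y \<inter> Y') = \<Union>Y \<inter> \<Union>Y'"
    and Union_classes_Diff: "\<Union> (Y - Y') = \<Union>Y - \<Union>Y'"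
proof -
  note sat = saturated_Union(1)[OF Y] saturated_Union(1)[OF Y']
  note eq = saturated_Union(2)[OF Y] saturated_Union(2)[OF Y']
  show "\<Union> (Y \<inter> Y') = \<Union>Y \<inter> \<Union>Y'"
    using Union_inf_class_image[OF saturated_boolean(4)[OF sat]]
    by (simp only: inf_class_image_Int[OF sat] eq)
  show "\<Union> (Y - Y') = \<Union>Y - \<Union>Y'"
    using Union_inf_class_image[OF saturated_Diff[OF sat]]
    by (simp only: inf_class_image_Diff[OF sat] eq)
qed

section \<open>The merged graph\<close>

lemma merged_graph_simps [simp]:
  "verts (merged_graph G L) = inf_class G L ` verts G"
  "arcs (merged_graph G L) =
     (\<lambda>e. (inf_class G L (tail G e), L e, inf_class G L (head G e))) ` arcs G"
  "tail (merged_graph G L) (x, a, y) = x"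
  "head (merged_graph G L) (x, a, y) = y"
  "merged_label (x, a, y) = a"
  by (auto simp: merged_graph_def merged_label_def)

lemma wf_digraph_merged_graph: "wf_digraph G \<Longrightarrow> wf_digraph (merged_graph G L)"
  by (auto simp: wf_digraph_def)

lemma merged_alphabet: "merged_label ` arcs (merged_graph G L) = L ` arcs G"
  by (simp add: image_image)

text \<open>
  For a saturated set it does not matter which arc of \<open>G\<close> represents an arc of the merged graph,
  because whether the source lies in \<open>A\<close> depends only on its class.
\<close>

lemma arcs_from_merged:
  assumes "wf_digraph G" "saturated G L A"
  shows "{e \<in> arcs (merged_graph G L). tail (merged_graph G L) e \<in> inf_class G L ` A \<and> P (merged_label e)}
    = (\<lambda>e. (inf_class G L (tail G e), L e, inf_class G L (head G e))) `
        {e \<in> arcs G. tail G e \<in> A \<and> P (L e)}"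
proof -
  have comp: "{x \<in> h ` S. Q x} = h ` {e \<in> S. Q (h e)}" for h :: "'x \<Rightarrow> 'y" and S Q
    by auto
  have "inf_class G L (tail G e) \<in> inf_class G L ` A \<longleftrightarrow> tail G e \<in> A" if "e \<in> arcs G" for e
    using that inf_class_mem_image_iff[OF assms(2)] wf_digraph.tail_in_verts[OF assms(1)] by blast
  then show ?thesis
    unfolding merged_graph_simps(2) comp by (simp cong: conj_cong)
qed

lemma out_labels_merged:
  assumes "wf_digraph G" "saturated G L A"
  shows "out_labels (merged_graph G L) merged_label (inf_class G L ` A) = out_labels G L A"
  using arcs_from_merged[OF assms, of "\<lambda>_. True"]
  unfolding out_labels_def by (simp add: image_image del: merged_graph_simps(2))

lemma rel_range_merged_letter:
  assumes "wf_digraph G" "saturated G L A"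
  shows "rel_range (merged_graph G L) merged_label (inf_class G L ` A) [a] =
    inf_class G L ` rel_range G L A [a]"
  using arcs_from_merged[OF assms, of "\<lambda>b. b = a"]
  unfolding wf_digraph.rel_range_letter[OF assms(1)]
    wf_digraph.rel_range_letter[OF wf_digraph_merged_graph[OF assms(1)]]
  by (simp add: image_image del: merged_graph_simps(2))

locale weakly_left_resolving_space = wf_digraph E
  for E :: "('v, 'e) pre_digraph" and L :: "'e \<Rightarrow> 'a" +
  assumes resolving: "weakly_left_resolving E L (bar_family E L)"
begin

abbreviation "F \<equiv> merged_graph E L"
abbreviation "LF \<equiv> (merged_label :: 'v set \<times> 'a \<times> 'v set \<Rightarrow> 'a)"

sublocale F: wf_digraph F
  using wf_digraph_axioms by (rule wf_digraph_merged_graph)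

lemma bar_closed_E: "bar_closed E L (bar_family E L)"
  using wf_digraph_axioms by (rule bar_closed_bar_family)

lemma bar_closed_F: "bar_closed F LF (bar_family F LF)"
  using F.wf_digraph_axioms by (rule bar_closed_bar_family)

text \<open>
  Prolonging a path with label \<open>x\<close> from \<open>u'\<close> to \<open>v'\<close> shows that \<open>v'\<close>, hence \<open>v\<close>, receives \<open>x @ w\<close>. So
  \<open>v\<close> is reached under \<open>w\<close> both from the range of \<open>x\<close> and from the generalized vertex of \<open>u\<close> of level
  \<open>length x\<close>. By weak left-resolvingness these two sets meet, and since the level is high enough to
  decide membership in the range of \<open>x\<close>, that range contains \<open>u\<close>.
\<close>

lemma in_word_range_transfer:
  assumes v: "v \<in> rel_range E L {u} w" and v': "v' \<in> rel_range E L {u'} w"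
    and eq: "v' \<in> inf_class E L v" and u': "u' \<in> word_range E L x"
  shows "u \<in> word_range E L x"
proof -
  have nonempty: "x \<noteq> []" "w \<noteq> []"
    using u' v by (auto simp: word_range_conv_rel_range intro: ccontr)
  have verts: "u \<in> verts E" "v \<in> verts E"
    using source_in_verts[OF v] rel_range_subset_verts v by blast+
  have "v' \<in> word_range E L (x @ w)"
    using v' u' nonempty rel_range_mono[of "{u'}" "word_range E L x" E L w]
    by (auto simp: word_range_append)
  then have "v \<in> word_range E L (x @ w)"
    using eq verts by (simp add: inf_class_iff)
  then have "v \<in> rel_range E L (word_range E L x) w"
    using nonempty by (simp add: word_range_append)
  moreover have "v \<in> rel_range E L (gen_vertex E L (length x) u) w"
    using v verts rel_range_mono[of "{u}" "gen_vertex E L (length x) u" E L w]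
    by (auto simp: gen_vertex_iff)
  moreover have "word_range E L x \<in> bar_family E L" "gen_vertex E L (length x) u \<in> bar_family E L"
    "w \<in> label_words E L"
    using bar_closed_E u' nonempty verts v rel_range_subset_word_range[of E L "{u}" w]
    by (auto simp: bar_closed_def accommodating_def label_words_iff Suc_le_eq)
  ultimately have "v \<in> rel_range E L (word_range E L x \<inter> gen_vertex E L (length x) u) w"
    using resolving unfolding weakly_left_resolving_def by blast
  then obtain y where "y \<in> word_range E L x" "y \<in> gen_vertex E L (length x) u"
    by (auto simp: rel_range_def)
  then show ?thesis
    by (auto simp: gen_vertex_iff)
qed

text \<open>
  By the preceding lemma, applied in both directions, equivalent vertices that are reached under the
  same word have equivalent sources.
\<close>

lemma saturated_rel_range:
  assumes A: "saturated E L A"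
  shows "saturated E L (rel_range E L A w)"
  unfolding saturated_def
proof (intro conjI ballI subsetI)
  fix v v' assume v: "v \<in> rel_range E L A w" and v': "v' \<in> inf_class E L v"
  have verts: "v \<in> verts E" "v' \<in> verts E"
    using v v' rel_range_subset_verts by (auto simp: inf_class_def)
  obtain u where u: "u \<in> A" "v \<in> rel_range E L {u} w"
    using v rel_range_singleton_source by metis
  have "v \<in> word_range E L w"
    using v rel_range_subset_word_range by fast
  then have "v' \<in> word_range E L w"
    using v' verts by (simp add: inf_class_iff)
  then obtain u' where u': "v' \<in> rel_range E L {u'} w"
    unfolding word_range_conv_rel_range using rel_range_singleton_source by metis
  have "v \<in> inf_class E L v'"
    using v' verts by (simp add: inf_class_iff)
  then have "u' \<in> inf_class E L u"
    using in_word_range_transfer[OF u(2) u' v'] in_word_range_transfer[OF u' u(2)]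
      source_in_verts[OF u'] source_in_verts[OF u(2)] by (auto simp: inf_class_iff)
  then have "u' \<in> A"
    using A u by (auto simp: saturated_def)
  then show "v' \<in> rel_range E L A w"
    using u' rel_range_singleton_source by metis
qed (use rel_range_subset_verts in blast)

text \<open>
  Saturation is what allows the induction: consecutive arcs of a path in the merged graph meet
  only up to equivalence in \<open>E\<close>, and the range of the first letter is again saturated.
\<close>

lemma rel_range_merged:
  "saturated E L A \<Longrightarrow>
    rel_range F LF (inf_class E L ` A) w = inf_class E L ` rel_range E L A w"
proof (induction w arbitrary: A)
  case (Cons a w)
  show ?case
  proof (cases "w = []")
    case True
    then show ?thesis
      using rel_range_merged_letter[OF wf_digraph_axioms Cons.prems] by simp
  next
    case False
    then show ?thesis
      using rel_range_append[of "[a]" w L A] F.rel_range_append[of "[a]" w LF]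
        rel_range_merged_letter[OF wf_digraph_axioms Cons.prems]
        Cons.IH[OF saturated_rel_range[OF Cons.prems]] by simp
  qed
qed simp

lemma word_range_merged: "word_range F LF w = inf_class E L ` word_range E L w"
  using rel_range_merged[OF saturated_boolean(2)]
  by (simp add: word_range_conv_rel_range F.word_range_conv_rel_range)

lemma label_words_merged: "label_words F LF = label_words E L"
  by (rule Set.set_eqI) (simp add: label_words_iff word_range_merged)

lemma gen_vertex_merged:
  assumes "v \<in> verts E"
  shows "gen_vertex F LF l (inf_class E L v) = inf_class E L ` gen_vertex E L l v"
proof -
  have mem: "inf_class E L u \<in> word_range F LF w \<longleftrightarrow> u \<in> word_range E L w"
    if "u \<in> verts E" for u w
    unfolding word_range_merged
    using inf_class_mem_image_iff[OF saturated_word_range[OF wf_digraph_axioms] that] .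
  have "inf_class E L u \<in> gen_vertex F LF l (inf_class E L v) \<longleftrightarrow> u \<in> gen_vertex E L l v"
    if "u \<in> verts E" for u
    unfolding gen_vertex_iff using that assms by (simp add: mem)
  moreover have "gen_vertex F LF l (inf_class E L v) \<subseteq> inf_class E L ` verts E"
    "gen_vertex E L l v \<subseteq> verts E"
    by (auto simp: gen_vertex_def)
  ultimately show ?thesis by blast
qed

text \<open>
  The sets on the right satisfy the closure conditions for \<open>E\<close>, because \<open>A \<mapsto> inf_class E L ` A\<close> commutes
  with all operations involved on saturated sets.
\<close>

lemma bar_family_subset_saturated:
  "bar_family E L \<subseteq> {A. saturated E L A \<and> inf_class E L ` A \<in> bar_family F LF}"
proof (rule bar_family_least)
  show "bar_closed E L {A. saturated E L A \<and> inf_class E L ` A \<in> bar_family F LF}"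
    using bar_closed_F unfolding bar_closed_def accommodating_def
    by (auto simp: saturated_word_range[OF wf_digraph_axioms] saturated_rel_range saturated_boolean
        saturated_Diff saturated_gen_vertex label_words_merged image_Un inf_class_image_Int
        inf_class_image_Diff simp flip: word_range_merged rel_range_merged gen_vertex_merged)
      (auto simp: saturated_def)
qed

text \<open>
  The converse inclusion, by minimality of the family of the merged graph.
\<close>

lemma bar_family_merged_subset:
  "bar_family F LF \<subseteq> {Y. Y \<subseteq> verts F \<and> \<Union>Y \<in> bar_family E L}"
proof (rule bar_family_least)
  have wr: "\<Union> (word_range F LF w) = word_range E L w" for w
    by (simp add: word_range_merged Union_inf_class_image saturated_word_range[OF wf_digraph_axioms])
  have rr: "\<Union> (rel_range F LF Y w) = rel_range E L (\<Union>Y) w" if "Y \<subseteq> verts F" for Y w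
    using rel_range_merged[of "\<Union>Y" w] saturated_Union[of Y E L] that
    by (simp add: Union_inf_class_image saturated_rel_range)
  have int: "\<Union> (Y \<inter> Y') = \<Union>Y \<inter> \<Union>Y'" and diff: "\<Union> (Y - Y') = \<Union>Y - \<Union>Y'"
    if "Y \<subseteq> verts F" "Y' \<subseteq> verts F" for Y Y'
    using that by (auto simp only: merged_graph_simps Union_classes_Int Union_classes_Diff)
  have gv: "\<Union> (gen_vertex F LF l (inf_class E L v)) = gen_vertex E L l v" if "v \<in> verts E" for l v
    using that by (simp add: gen_vertex_merged Union_inf_class_image saturated_gen_vertex)
  show "bar_closed F LF {Y. Y \<subseteq> verts F \<and> \<Union>Y \<in> bar_family E L}"
    unfolding bar_closed_def accommodating_def
  proof (intro conjI ballI allI impI)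
    fix x l assume "x \<in> verts F" "1 \<le> (l::nat)"
    then show "gen_vertex F LF l x \<in> {Y. Y \<subseteq> verts F \<and> \<Union>Y \<in> bar_family E L}"
      using bar_closed_E gv unfolding bar_closed_def by (auto simp: gen_vertex_def)
  qed (use bar_closed_E wr rr int diff in
      \<open>auto simp: bar_closed_def accommodating_def label_words_merged 
        simp del: merged_graph_simps
        dest: subsetD[OF F.word_range_subset_verts] subsetD[OF F.rel_range_subset_verts]\<close>)
qed

lemma singleton_in_bar_family_merged:
  assumes v: "v \<in> verts E" and fin: "finite (gen_vertex E L l v)"
  shows "{inf_class E L v} \<in> bar_family F LF"
proof -
  obtain m where m: "m \<ge> 1" "inf_class E L v = gen_vertex E L m v"
    using inf_class_eq_gen_vertex[OF v fin] .
  have "inf_class E L ` inf_class E L v = {inf_class E L v}"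
    using v inf_class_self[OF v] inf_class_eq_iff[OF v] by (auto simp: inf_class_def)
  moreover have "inf_class E L v \<in> bar_family E L"
    using m v bar_closed_E by (simp add: bar_closed_def)
  ultimately show ?thesis
    using bar_family_subset_saturated by force
qed

end

section \<open>Comparison of the universal C*-algebras\<close>

text \<open>
  The relations of a representation mention a set only through the Boolean operations, the labels it
  emits and its relative ranges under single letters. A map of set families that respects these
  therefore transports representations.
\<close>

lemma representation_pullback:
  assumes rep: "representation G L B X p s"
    and closed: "\<And>A. A \<in> B' \<Longrightarrow> h A \<in> B"
    and alphabet: "L' ` arcs G' = L ` arcs G"
    and h_empty: "h {} = {}"
    and h_Int: "\<And>A A'. \<lbrakk>A \<in> B'; A' \<in> B'\<rbrakk> \<Longrightarrow> h (A \<inter> A') = h A \<inter> h A'"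
    and h_Un: "\<And>A A'. \<lbrakk>A \<in> B'; A' \<in> B'\<rbrakk> \<Longrightarrow> h (A \<union> A') = h A \<union> h A'"
    and h_rel: "\<And>A a. A \<in> B' \<Longrightarrow> h (rel_range G' L' A [a]) = rel_range G L (h A) [a]"
    and h_word: "\<And>a. h (word_range G' L' [a]) = word_range G L [a]"
    and h_out: "\<And>A. A \<in> B' \<Longrightarrow> out_labels G' L' A = out_labels G L (h A)"
  shows "representation G' L' B' X (\<lambda>A. p (h A)) s"
  using rep unfolding representation_def alphabet
  by (simp add: closed h_empty h_Int h_Un h_rel h_word h_out)

text \<open>
  The universal properties yield *-homomorphisms \<open>f\<close> and \<open>g\<close> that exchange the generators. The
  uniqueness needed to invert them is not part of the universal property; it comes from the
  generators.
\<close>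

lemma labelled_space_cstar_isomorphic:
  fixes C D :: "'u star_algebra"
  assumes C: "is_labelled_space_cstar G L B C" and D: "is_labelled_space_cstar G' L' B' D"
    and alphabet: "L' ` arcs G' = L ` arcs G"
    and inv: "\<And>A. A \<in> B \<Longrightarrow> k A \<in> B' \<and> h (k A) = A" "\<And>A. A \<in> B' \<Longrightarrow> h A \<in> B \<and> k (h A) = A"
    and pull: "\<And>X p s. representation G L B X p s \<Longrightarrow>
      representation G' L' B' (X :: 'u star_algebra) (\<lambda>A. p (h A)) s"
    and push: "\<And>X p s. representation G' L' B' X p s \<Longrightarrow>
      representation G L B (X :: 'u star_algebra) (\<lambda>A. p (k A)) s"
  shows "cstar_isomorphic C D"
proof -
  obtain p s where cC: "cstar_algebra C" and rep: "representation G L B C p s"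
    and gen: "generates C (p ` B \<union> s ` L ` arcs G)"
    and univ: "\<And>X q t. cstar_algebra X \<Longrightarrow> representation G L B (X :: 'u star_algebra) q t \<Longrightarrow>
      \<exists>f. star_hom C X f \<and> (\<forall>A \<in> B. f (p A) = q A) \<and> (\<forall>a \<in> L ` arcs G. f (s a) = t a)"
    using C unfolding is_labelled_space_cstar_def by blast
  obtain q t where cD: "cstar_algebra D" and rep': "representation G' L' B' D q t"
    and gen': "generates D (q ` B' \<union> t ` L' ` arcs G')"
    and univ': "\<And>X p s. cstar_algebra X \<Longrightarrow> representation G' L' B' (X :: 'u star_algebra) p s \<Longrightarrow>
      \<exists>f. star_hom D X f \<and> (\<forall>A \<in> B'. f (q A) = p A) \<and> (\<forall>a \<in> L' ` arcs G'. f (t a) = s a)"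
    using D unfolding is_labelled_space_cstar_def by blast
  obtain f where f: "star_hom C D f" "\<And>A. A \<in> B \<Longrightarrow> f (p A) = q (k A)"
    "\<And>a. a \<in> L ` arcs G \<Longrightarrow> f (s a) = t a"
    using univ[OF cD push[OF rep']] by blast
  obtain g where g: "star_hom D C g" "\<And>A. A \<in> B' \<Longrightarrow> g (q A) = p (h A)"
    "\<And>a. a \<in> L' ` arcs G' \<Longrightarrow> g (t a) = s a"
    using univ'[OF cC pull[OF rep]] by blast
  have "(g \<circ> f) x = id x" if "x \<in> p ` B \<union> s ` L ` arcs G" for x
    using that inv f(2,3) g(2,3) alphabet by auto
  then have gf: "g (f x) = x" if "x \<in> carrier C" for x
    using star_hom_eq_on_generators[OF cC cC star_hom_comp[OF f(1) g(1)] star_hom_id gen _ that]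
    by simp
  have "(f \<circ> g) x = id x" if "x \<in> q ` B' \<union> t ` L' ` arcs G'" for x
    using that inv f(2,3) g(2,3) alphabet by auto
  then have fg: "f (g x) = x" if "x \<in> carrier D" for x
    using star_hom_eq_on_generators[OF cD cD star_hom_comp[OF g(1) f(1)] star_hom_id gen' _ that]
    by simp
  have "bij_betw f (carrier C) (carrier D)"
    using f(1) g(1) gf fg by (intro bij_betw_byWitness[where f' = g]) (auto simp: star_hom_def)
  then show ?thesis
    using cC cD f(1) by (auto simp: cstar_isomorphic_def)
qed

theorem theorem6p10:
  fixes E :: "('v, 'e) pre_digraph" and L :: "'e \<Rightarrow> 'a"
  assumes space: "labelled_space E L (bar_family E L)"
    and "set_finite E L (bar_family E L)"
    and "receiver_set_finite E L (bar_family E L)"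
    and "weakly_left_resolving E L (bar_family E L)"
    and no_sinks: "no_sinks E"
    and "\<forall>v \<in> verts E. \<exists>l \<ge> 1. finite (gen_vertex E L l v)"
  shows "(\<forall>x \<in> verts (merged_graph E L).
            {x} \<in> bar_family (merged_graph E L) merged_label) \<and>
         (\<forall>(C :: 'u star_algebra) (D :: 'u star_algebra).
            is_labelled_space_cstar E L (bar_family E L) C \<longrightarrow>
            is_labelled_space_cstar (merged_graph E L) merged_label
              (bar_family (merged_graph E L) merged_label) D \<longrightarrow>
            cstar_isomorphic C D)"
proof -
  interpret wf_digraph E
    using space by (simp add: labelled_space_def labelled_graph_def)
  interpret weakly_left_resolving_space E L
    by unfold_locales fact
  have E_bar: "saturated E L A" "inf_class E L ` A \<in> bar_family F LF"
    if "A \<in> bar_family E L" for A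
    using that bar_family_subset_saturated by blast+
  note E_inv = Union_inf_class_image[OF E_bar(1)]
  have F_bar: "Y \<subseteq> verts F" "\<Union>Y \<in> bar_family E L" if "Y \<in> bar_family F LF" for Y
    using that bar_family_merged_subset by blast+
  have F_inv: "inf_class E L ` \<Union>Y = Y" if "Y \<in> bar_family F LF" for Y
    using saturated_Union(2)[of Y E L] F_bar(1)[OF that] by simp
  have transfer: "\<Union> (rel_range F LF Y [a]) = rel_range E L (\<Union>Y) [a]"
    "out_labels F LF Y = out_labels E L (\<Union>Y)"
    if "Y \<in> bar_family F LF" for Y a
    using rel_range_merged[of "\<Union>Y" "[a]"] out_labels_merged[OF wf_digraph_axioms, of L "\<Union>Y"]
      E_bar(1)[OF F_bar(2)[OF that]] F_inv[OF that]
    by (simp_all add: Union_inf_class_image saturated_rel_range)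
  have "cstar_isomorphic C D"
    if C: "is_labelled_space_cstar E L (bar_family E L) C"
      and D: "is_labelled_space_cstar F LF (bar_family F LF) D" for C D :: "'u star_algebra"
  proof (rule labelled_space_cstar_isomorphic[OF C D merged_alphabet,
        where h = Union and k = "\<lambda>A. inf_class E L ` A"])
    fix X :: "'u star_algebra" and p s
    assume rep: "representation E L (bar_family E L) X p s"
    show "representation F LF (bar_family F LF) X (\<lambda>Y. p (\<Union>Y)) s"
    proof (rule representation_pullback[OF rep _ merged_alphabet])
      fix Y Y' assume Y: "Y \<in> bar_family F LF" "Y' \<in> bar_family F LF"
      show "\<Union> (Y \<inter> Y') = \<Union>Y \<inter> \<Union>Y'"
        using F_bar(1)[OF Y(1)] F_bar(1)[OF Y(2)] by (simp add: Union_classes_Int)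
    qed (use F_bar(2) transfer in \<open>simp_all add: word_range_merged Union_inf_class_image
          saturated_word_range[OF wf_digraph_axioms]\<close>)
  next
    fix X :: "'u star_algebra" and p s
    assume rep: "representation F LF (bar_family F LF) X p s"
    show "representation E L (bar_family E L) X (\<lambda>A. p (inf_class E L ` A)) s"
      by (rule representation_pullback[OF rep _ merged_alphabet[symmetric]])
        (use E_bar in \<open>simp_all add: word_range_merged rel_range_merged inf_class_image_Int image_Un
          out_labels_merged[OF wf_digraph_axioms] del: merged_graph_simps\<close>)
  qed (simp_all add: E_bar(2) E_inv F_bar(2) F_inv)
  moreover have "{x} \<in> bar_family F LF" if "x \<in> verts F" for x
    using that assms singleton_in_bar_family_merged by force
  ultimately show ?thesis by blast
qed

end
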